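(* Let $n\ge 2$ and let $\vec{q}=(q_1,\ldots,q_n)$ satisfy $q_1+\ldots+q_n=1$ and $0<q_1<\ldots<q_n<1$. Let $$\ell^{(n)}_{[\vec{q}]}(\vec{x}):=\frac{1}{(n-1)!}\sum_{\sigma\in\mathfrak{P}_n}\max\{x_1\,q_{\sigma(1)},\ldots,x_n\,q_{\sigma(n)}\},\qquad \vec{x}\in[0,\infty)^n,$$ where $\mathfrak{P}_n$ is the set of permutations of $\{1,\ldots,n\}$; this is an element of the set $\mathfrak{L}^X_n$ of symmetric $n$-variate stable tail dependence functions. Then for every $d\ge n+1$, $\ell^{(n)}_{[\vec{q}]}$ is not an $n$-margin of any $\ell\in\mathfrak{L}^X_d$; that is, there is no $\ell\in\mathfrak{L}^X_d$ with $$\ell(x_1,\ldots,x_n,0,\ldots,0)=\ell^{(n)}_{[\vec{q}]}(x_1,\ldots,x_n)\quad\text{for all }(x_1,\ldots,x_n)\in[0,\infty)^n.$$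
   Context: A $d$-variate extreme-value copula is a distribution function $C:[0,1]^d\to[0,1]$ with one-dimensional margins uniform on $[0,1]$ satisfying $C(u_1^t,\ldots,u_d^t)=C(u_1,\ldots,u_d)^t$ for all $\vec{u}\in[0,1]^d$, $t>0$. Its stable tail dependence function is $\ell(\vec{x}):=-\log C(e^{-x_1},\ldots,e^{-x_d})$, $\vec{x}\in[0,\infty)^d$. With $S_d:=\{\vec{x}\in[0,1]^d:x_1+\ldots+x_d=1\}$, a classical result of Pickands states that $\ell:[0,\infty)^d\to[0,\infty)$ is the stable tail dependence function of some $d$-variate extreme-value copula if and only if there is a random vector $\vec{Q}=(Q_1,\ldots,Q_d)$ with values in $S_d$ and $\mathbb{E}[Q_k]=1/d$ for $k=1,\ldots,d$ such that $\ell(\vec{x})=d\,\mathbb{E}[\max\{x_1Q_1,\ldots,x_dQ_d\}]$ for all $\vec{x}$; moreover the law of $\vec{Q}$ is uniquely determined by $\ell$. $\mathfrak{L}^X_d$ denotes the set of all $d$-variate stable tail dependence functions that are symmetric, i.e. invariant under permutations of their arguments (these correspond to the exchangeable extreme-value copulas). *)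

theory Defs
  imports "HOL-Probability.Probability" "HOL-Combinatorics.Combinatorics"
begin

text \<open>
  A vector of length \<open>d\<close> is a function on \<open>{1..d}\<close>, extended by \<open>undefined\<close> outside, so that
  vectors are points of the product space \<open>\<Pi>\<^sub>M i\<in>{1..d}. borel\<close>.  A function on \<open>[0,1]^d\<close> or
  \<open>[0,\<infinity>)^d\<close> is a HOL function on all vectors, whose values off that domain never matter.
\<close>

definition cube :: "nat \<Rightarrow> (nat \<Rightarrow> real) set" where
  "cube d = {1..d} \<rightarrow>\<^sub>E {0..1}"

definition orthant :: "nat \<Rightarrow> (nat \<Rightarrow> real) set" where
  "orthant d = {1..d} \<rightarrow>\<^sub>E {0..}"

definition is_copula :: "nat \<Rightarrow> ((nat \<Rightarrow> real) \<Rightarrow> real) \<Rightarrow> bool" where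
  "is_copula d C \<longleftrightarrow>
    (\<exists>M. prob_space M \<and>
         sets M = sets (\<Pi>\<^sub>M i\<in>{1..d}. (borel :: real measure)) \<and>
         (\<forall>k\<in>{1..d}. distr M borel (\<lambda>y. y k) = uniform_measure lborel {0..1}) \<and>
         (\<forall>u\<in>cube d. C u = measure M {y \<in> space M. \<forall>k\<in>{1..d}. y k \<le> u k}))"

definition is_ev_copula :: "nat \<Rightarrow> ((nat \<Rightarrow> real) \<Rightarrow> real) \<Rightarrow> bool" where
  "is_ev_copula d C \<longleftrightarrow>
    is_copula d C \<and>
    (\<forall>u\<in>cube d. \<forall>t>0. C (\<lambda>k\<in>{1..d}. u k powr t) = C u powr t)"

definition is_stdf :: "nat \<Rightarrow> ((nat \<Rightarrow> real) \<Rightarrow> real) \<Rightarrow> bool" where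
  "is_stdf d l \<longleftrightarrow>
    (\<exists>C. is_ev_copula d C \<and>
         (\<forall>x\<in>orthant d. l x = - ln (C (\<lambda>k\<in>{1..d}. exp (- x k)))))"

text \<open>
  If \<open>p\<close> permutes \<open>{1..d}\<close>, it fixes every index outside \<open>{1..d}\<close>, so \<open>x \<circ> p\<close> is again a vector
  of length \<open>d\<close>.
\<close>

definition sym_stdfs :: "nat \<Rightarrow> ((nat \<Rightarrow> real) \<Rightarrow> real) set" where
  "sym_stdfs d =
    {l. is_stdf d l \<and> (\<forall>p. p permutes {1..d} \<longrightarrow> (\<forall>x\<in>orthant d. l (x \<circ> p) = l x))}"

definition ell_perm :: "nat \<Rightarrow> (nat \<Rightarrow> real) \<Rightarrow> (nat \<Rightarrow> real) \<Rightarrow> real" where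
  "ell_perm n q x =
    1 / fact (n - 1) * (\<Sum>\<sigma> | \<sigma> permutes {1..n}. Max ((\<lambda>i. x i * q (\<sigma> i)) ` {1..n}))"

definition is_margin ::
    "nat \<Rightarrow> ((nat \<Rightarrow> real) \<Rightarrow> real) \<Rightarrow> nat \<Rightarrow> ((nat \<Rightarrow> real) \<Rightarrow> real) \<Rightarrow> bool" where
  "is_margin n f d l \<longleftrightarrow>
    (\<forall>x\<in>orthant n. l (\<lambda>k\<in>{1..d}. if k \<le> n then x k else 0) = f x)"

end

theory Submission
  imports Defs
begin

text \<open>
  Attach independent unit exponential clocks \<open>e \<sigma>\<close> to the permutations and let
  \<open>X i = min\<^sub>\<sigma> e \<sigma> (n - 1)! / q (\<sigma> i)\<close>; then \<open>exp (- X)\<close> has an extreme-value copula as its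
  distribution function, with stable tail dependence function \<open>ell_perm n q\<close>.

  The impossibility argument avoids Pickands' representation.  If \<open>Y\<close> has the copula of a symmetric
  extension, then any \<open>n\<close> of the variables \<open>- ln Y\<^sub>k\<close> are distributed like \<open>X\<close>.  Up to an event of
  probability \<open>O(\<delta>\<^sup>2)\<close> at most one clock is of order \<open>\<delta>\<close>, and then \<open>X\<close>, as soon as it has a
  coordinate of order \<open>\<delta>\<close>, is a multiple of \<open>(1 / q (\<sigma> i))\<^sub>i\<close>: its coordinates are distinct, with
  ratio of largest to smallest exactly \<open>q n / q 1\<close>.  Since \<open>- ln Y\<^sub>1 < \<delta>\<close> has probability of order
  \<open>\<delta>\<close>, some outcome gives \<open>n + 1\<close> positive numbers all of whose \<open>n\<close>-subfamilies have this
  property.  That is absurd: omitting either the largest or a middle number shows that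
  \<open>q n / q 1\<close> times the smallest number occurs twice.
\<close>

declare One_nat_def [simp del]

section \<open>Laws on the unit cube and the exponential law\<close>

text \<open>Lower orthants are closed under intersection, generate the product sigma-algebra over a
  finite index set and exhaust the space along integer corners, so the joint distribution function
  determines the law.\<close>

lemma PiM_borel_eqI:
  fixes P Q :: "('i \<Rightarrow> real) measure"
  assumes I: "finite I"
    and P: "prob_space P" "sets P = sets (\<Pi>\<^sub>M i\<in>I. borel)"
    and Q: "prob_space Q" "sets Q = sets (\<Pi>\<^sub>M i\<in>I. borel)"
    and cdf: "\<And>a. measure P {y \<in> space P. \<forall>i\<in>I. y i \<le> a i} = measure Q {y \<in> space Q. \<forall>i\<in>I. y i \<le> a i}"
  shows "P = Q"
proof -
  interpret P: prob_space P by fact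
  interpret Q: prob_space Q by fact
  have sp: "space P = I \<rightarrow>\<^sub>E UNIV" "space Q = I \<rightarrow>\<^sub>E UNIV"
    using sets_eq_imp_space_eq[OF P(2)] sets_eq_imp_space_eq[OF Q(2)] by (simp_all add: space_PiM)
  define H :: "('i \<Rightarrow> real) \<Rightarrow> ('i \<Rightarrow> real) set"
    where "H a = {y \<in> I \<rightarrow>\<^sub>E UNIV. \<forall>i\<in>I. y i \<le> a i}" for a
  have gen: "sets (\<Pi>\<^sub>M i\<in>I. (borel :: real measure)) = sigma_sets (I \<rightarrow>\<^sub>E UNIV) (range H)"
  proof -
    \<comment> \<open>This is the generator that \<open>sets_PiM_sigma\<close> yields when
      \<open>I\<close> is covered by the single finite set \<open>I\<close>.\<close>
    let ?G = "{{f \<in> I \<rightarrow>\<^sub>E UNIV. \<forall>i\<in>j. f i \<in> A i} | A j. j \<in> {I} \<and> A \<in> (\<Pi> i\<in>j. range (atMost :: real \<Rightarrow> _))}"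
    have "sets (\<Pi>\<^sub>M i\<in>I. (borel :: real measure)) = sets (sigma (I \<rightarrow>\<^sub>E UNIV) ?G)"
      unfolding borel_eq_atMost
    proof (rule sets_PiM_sigma)
      show "\<exists>S\<subseteq>range (atMost :: real \<Rightarrow> _). countable S \<and> UNIV = \<Union>S"
        by (intro exI[of _ "range (\<lambda>n::nat. {..real n})"]) (auto simp: real_arch_simple)
    qed (use I in auto)
    also have "?G = range H"
    proof safe
      fix A assume "A \<in> (\<Pi> i\<in>I. range (atMost :: real \<Rightarrow> _))"
      then have "\<forall>i\<in>I. \<exists>a. A i = {..a}" by blast
      then obtain a where a: "\<forall>i\<in>I. A i = {..a i}" by metis
      have "{f \<in> I \<rightarrow>\<^sub>E UNIV. \<forall>i\<in>I. f i \<in> A i} = H a" using a by (auto simp: H_def)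
      then show "{f \<in> I \<rightarrow>\<^sub>E UNIV. \<forall>i\<in>I. f i \<in> A i} \<in> range H" by blast
    next
      fix a show "\<exists>A j. H a = {f \<in> I \<rightarrow>\<^sub>E UNIV. \<forall>i\<in>j. f i \<in> A i} \<and> j \<in> {I} \<and> A \<in> (\<Pi> i\<in>j. range atMost)"
        by (intro exI[of _ "\<lambda>i. {..a i}"] exI[of _ I]) (auto simp: H_def)
    qed
    also have "sets (sigma (I \<rightarrow>\<^sub>E UNIV) (range H)) = sigma_sets (I \<rightarrow>\<^sub>E UNIV) (range H)"
      by (rule sets_measure_of) (auto simp: H_def)
    finally show ?thesis .
  qed
  show ?thesis
  proof (rule measure_eqI_generator_eq[where E = "range H" and \<Omega> = "I \<rightarrow>\<^sub>E UNIV"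
        and A = "\<lambda>n. H (\<lambda>_. real n)"])
    have "H a \<inter> H b = H (\<lambda>i. min (a i) (b i))" for a b
      by (auto simp: H_def)
    then show "Int_stable (range H)" by (auto intro!: Int_stableI)
    show "emeasure P X = emeasure Q X" if "X \<in> range H" for X
      using that cdf by (auto simp: sp H_def P.emeasure_eq_measure Q.emeasure_eq_measure)
    show "(\<Union>n. H (\<lambda>_. real n)) = I \<rightarrow>\<^sub>E UNIV"
    proof
      show "I \<rightarrow>\<^sub>E UNIV \<subseteq> (\<Union>n. H (\<lambda>_. real n))"
      proof
        fix y :: "'i \<Rightarrow> real" assume y: "y \<in> I \<rightarrow>\<^sub>E UNIV"
        obtain n :: nat where n: "(\<Sum>i\<in>I. \<bar>y i\<bar>) \<le> n" using real_arch_simple by blast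
        have "y i \<le> n" if "i \<in> I" for i
          using member_le_sum[of i I "\<lambda>i. \<bar>y i\<bar>"] n I that by auto
        then show "y \<in> (\<Union>n. H (\<lambda>_. real n))" using y by (auto simp: H_def)
      qed
    qed (auto simp: H_def)
    show "emeasure P (H (\<lambda>_. real n)) \<noteq> \<infinity>" for n by simp
  qed (use P Q gen in \<open>auto simp: H_def\<close>)
qed

text \<open>A stable tail dependence function gives the distribution function only where logarithms
  make sense. Since almost all mass has coordinates in \<open>(0, 1]\<close>, a general corner
  reduces to that range: a nonpositive entry gives probability 0, and entries above 1 may be cut
  down to 1.\<close>

lemma PiM_borel_eqI_unit_cube:
  fixes P Q :: "('i \<Rightarrow> real) measure"
  assumes I: "finite I"
    and P: "prob_space P" "sets P = sets (\<Pi>\<^sub>M i\<in>I. borel)"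
    and Q: "prob_space Q" "sets Q = sets (\<Pi>\<^sub>M i\<in>I. borel)"
    and AE: "\<And>i. i \<in> I \<Longrightarrow> AE y in P. 0 < y i \<and> y i \<le> 1" "\<And>i. i \<in> I \<Longrightarrow> AE y in Q. 0 < y i \<and> y i \<le> 1"
    and cdf: "\<And>u. (\<And>i. i \<in> I \<Longrightarrow> 0 < u i \<and> u i \<le> 1) \<Longrightarrow>
      measure P {y \<in> space P. \<forall>i\<in>I. y i \<le> u i} = measure Q {y \<in> space Q. \<forall>i\<in>I. y i \<le> u i}"
  shows "P = Q"
proof (rule PiM_borel_eqI[OF I P Q])
  fix a :: "'i \<Rightarrow> real"
  have ev: "{y \<in> space R. \<forall>i\<in>I. y i \<le> b i} \<in> sets R"
    if "sets R = sets (\<Pi>\<^sub>M i\<in>I. borel)" for R and b :: "'i \<Rightarrow> real"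
  proof -
    have [measurable_cong]: "sets R = sets (\<Pi>\<^sub>M i\<in>I. borel)" by fact
    show ?thesis using I by measurable
  qed
  have clamp: "measure R {y \<in> space R. \<forall>i\<in>I. y i \<le> a i}
      = (if \<forall>i\<in>I. 0 < a i then measure R {y \<in> space R. \<forall>i\<in>I. y i \<le> min (a i) 1} else 0)"
    if R: "prob_space R" "sets R = sets (\<Pi>\<^sub>M i\<in>I. borel)"
      and AE: "\<And>i. i \<in> I \<Longrightarrow> AE y in R. 0 < y i \<and> y i \<le> 1" for R
  proof -
    interpret R: prob_space R by fact
    have AE': "AE y in R. \<forall>i\<in>I. 0 < y i \<and> y i \<le> 1"
      using I AE by (simp add: AE_finite_allI)
    show ?thesis
    proof (cases "\<forall>i\<in>I. 0 < a i")
      case True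
      have "measure R {y \<in> space R. \<forall>i\<in>I. y i \<le> a i} = measure R {y \<in> space R. \<forall>i\<in>I. y i \<le> min (a i) 1}"
        by (rule R.finite_measure_eq_AE) (use AE' ev[OF R(2), of a] ev[OF R(2), of "\<lambda>i. min (a i) 1"] in auto)
      then show ?thesis using True by simp
    next
      case False
      then obtain i where i: "i \<in> I" "a i \<le> 0" by force
      have "measure R {y \<in> space R. \<forall>i\<in>I. y i \<le> a i} = measure R {}"
      proof (rule R.finite_measure_eq_AE)
        show "AE y in R. y \<in> {y \<in> space R. \<forall>i\<in>I. y i \<le> a i} \<longleftrightarrow> y \<in> {}"
          using AE[OF i(1)] by eventually_elim (use i in \<open>auto intro!: bexI[OF _ i(1)]\<close>)
      qed (use ev[OF R(2)] in auto)
      then show ?thesis unfolding if_not_P[OF False] by simp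
    qed
  qed
  show "measure P {y \<in> space P. \<forall>i\<in>I. y i \<le> a i} = measure Q {y \<in> space Q. \<forall>i\<in>I. y i \<le> a i}"
    using clamp[OF P AE(1)] clamp[OF Q AE(2)] cdf[of "\<lambda>i. min (a i) 1"] by auto
qed

section \<open>The uniform law on the unit interval\<close>

lemma uniform_unit_prob_space: "prob_space (uniform_measure lborel {0..1::real})"
  by (intro prob_space_uniform_measure) auto

lemma measure_uniform_unit_le:
  assumes "0 \<le> u" "u \<le> 1"
  shows "measure (uniform_measure lborel {0..1::real}) {..u} = u"
proof -
  have "{0..1} \<inter> {..u} = {0..u}" using assms by auto
  then show ?thesis using assms by (subst measure_uniform_measure) auto
qed

text \<open>Monotonicity supplies the remaining values: up to 0 the distribution function is
  squeezed by its arbitrarily small values right of 0, and beyond 1 it cannot drop below its value 1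
  at 1.\<close>

lemma uniform_unitI:
  assumes N: "real_distribution N" and u: "\<And>u. 0 < u \<Longrightarrow> u \<le> 1 \<Longrightarrow> cdf N u = u"
  shows "N = uniform_measure lborel {0..1}"
proof (rule cdf_unique[OF N])
  interpret N: real_distribution N by fact
  interpret U: prob_space "uniform_measure lborel {0..1::real}" by (rule uniform_unit_prob_space)
  show U': "real_distribution (uniform_measure lborel {0..1::real})"
    by unfold_locales auto
  interpret U: real_distribution "uniform_measure lborel {0..1::real}" by fact
  have eq: "cdf R t = max 0 (min 1 t)"
    if R: "real_distribution R" and u: "\<And>u. 0 < u \<Longrightarrow> u \<le> 1 \<Longrightarrow> cdf R u = u" for R t
  proof -
    interpret R: real_distribution R by fact
    have nn: "0 \<le> cdf R t" "cdf R t \<le> 1" by (auto simp: cdf_def)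
    consider "t \<le> 0" | "0 < t" "t \<le> 1" | "1 < t" by linarith
    then show ?thesis
    proof cases
      case 1
      have "cdf R t \<le> e" if "0 < e" for e
      proof -
        have "cdf R t \<le> cdf R (min e 1)" using 1 that by (intro R.cdf_nondecreasing) auto
        then show ?thesis using u[of "min e 1"] that by auto
      qed
      then have "cdf R t \<le> 0" by (rule field_le_epsilon[of "cdf R t" 0, simplified])
      then show ?thesis using nn 1 by auto
    next
      case 3
      have "cdf R 1 \<le> cdf R t" using 3 by (intro R.cdf_nondecreasing) auto
      then show ?thesis using nn 3 u[of 1] by auto
    qed (use u in auto)
  qed
  show "cdf N = cdf (uniform_measure lborel {0..1})"
    using eq[OF N u] eq[OF U'] measure_uniform_unit_le by (auto simp: cdf_def)
qed

lemma AE_uniform_unit: "AE x in uniform_measure lborel {0..1::real}. 0 < x \<and> x \<le> 1"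
proof -
  have "AE x in lborel. x \<noteq> (0::real)" by (rule AE_lborel_singleton)
  then show ?thesis by (subst AE_uniform_measure) (auto simp: less_le)
qed

lemma AE_uniform_margin:
  assumes "distr M borel (\<lambda>y. y k) = uniform_measure lborel {0..1::real}" "(\<lambda>y. y k) \<in> borel_measurable M"
  shows "AE y in M. 0 < y k \<and> y k \<le> 1"
  using AE_uniform_unit unfolding assms(1)[symmetric] by (subst (asm) AE_distr_iff) (use assms in auto)

section \<open>The unit exponential law\<close>

abbreviation expo :: "real measure" where
  "expo \<equiv> density lborel (exponential_density 1)"

lemma prob_space_expo: "prob_space expo"
  by (rule prob_space_exponential_density) simp

text \<open>There are no atoms, so the closed half-line has the mass of the open one, which is the
  exponential tail.\<close>

lemma measure_expo_ge:
  assumes "0 \<le> a"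
  shows "measure expo {a..} = exp (- a)"
proof -
  interpret prob_space expo by (rule prob_space_expo)
  have D: "distributed expo lborel (\<lambda>x. x) (exponential_density 1)"
    unfolding distributed_def by (auto simp: distr_id2 erlang_density_def)
  have "measure expo {a..} = measure expo {a<..}"
  proof (rule finite_measure_eq_AE)
    have "AE x in lborel. x \<noteq> a" by (rule AE_lborel_singleton)
    then show "AE x in expo. x \<in> {a..} \<longleftrightarrow> x \<in> {a<..}"
      by (subst AE_density) (auto simp: less_le)
  qed auto
  also have "\<dots> = exp (- a)"
    using exponential_distributedD_gt[OF D assms] by (simp add: greaterThan_def)
  finally show ?thesis .
qed

text \<open>Since \<open>1 - exp (- a) \<le> a\<close>. This linear bound for one clock becomes
  quadratic for two independent clocks.\<close>

lemma measure_expo_less: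
  assumes "0 \<le> a"
  shows "measure expo {..<a} \<le> a"
proof -
  interpret prob_space expo by (rule prob_space_expo)
  have "measure expo {..<a} = 1 - measure expo {a..}"
    by (subst prob_compl[symmetric]) (auto intro!: arg_cong[where f = "measure expo"])
  then show ?thesis using measure_expo_ge[OF assms] exp_ge_add_one_self[of "- a"] by simp
qed

lemma AE_expo_pos: "AE x in expo. 0 < x"
proof -
  have "AE x in lborel. x \<noteq> (0::real)" by (rule AE_lborel_singleton)
  then show ?thesis by (subst AE_density) (auto simp: erlang_density_def less_le)
qed

section \<open>The clock model\<close>

lemma Max_mult_left:
  fixes f :: "'i \<Rightarrow> real"
  assumes "finite S" "S \<noteq> {}" "0 \<le> t"
  shows "Max ((\<lambda>i. t * f i) ` S) = t * Max (f ` S)"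
  using mono_Max_commute[of "(*) t" "f ` S"] assms
  by (simp add: mono_def mult_left_mono image_image)

lemma ell_perm_cong:
  "(\<And>i. i \<in> {1..n} \<Longrightarrow> x i = y i) \<Longrightarrow> ell_perm n q x = ell_perm n q y"
  unfolding ell_perm_def
  by (intro arg_cong2[where f = "(*)"] sum.cong arg_cong[where f = Max] image_cong) auto

lemma ell_perm_scale:
  assumes "1 \<le> n" "0 \<le> t"
  shows "ell_perm n q (\<lambda>i. t * x i) = t * ell_perm n q x"
proof -
  have "Max ((\<lambda>i. t * x i * q (\<sigma> i)) ` {1..n}) = t * Max ((\<lambda>i. x i * q (\<sigma> i)) ` {1..n})" for \<sigma>
    using Max_mult_left[of "{1..n}" t "\<lambda>i. x i * q (\<sigma> i)"] assms by (simp add: mult.assoc)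
  then show ?thesis by (simp add: ell_perm_def sum_distrib_left algebra_simps)
qed

text \<open>Replacing \<open>\<sigma>\<close> by \<open>\<sigma> \<circ> p\<close> only reorders the
  sum, and then \<open>p\<close> merely reorders the terms inside each maximum.\<close>

lemma ell_perm_permute:
  assumes p: "p permutes {1..n}"
  shows "ell_perm n q (x \<circ> p) = ell_perm n q x"
proof -
  let ?f = "\<lambda>\<sigma>. Max ((\<lambda>i. x i * q (\<sigma> i)) ` {1..n})"
  have "Max ((\<lambda>i. (x \<circ> p) i * q ((\<sigma> \<circ> p) i)) ` {1..n}) = ?f \<sigma>" for \<sigma>
  proof -
    have "(\<lambda>i. (x \<circ> p) i * q ((\<sigma> \<circ> p) i)) ` {1..n} = (\<lambda>i. x i * q (\<sigma> i)) ` p ` {1..n}"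
      by (simp add: image_image)
    then show ?thesis by (simp only: permutes_image[OF p])
  qed
  then have "(\<Sum>\<sigma> | \<sigma> permutes {1..n}. Max ((\<lambda>i. (x \<circ> p) i * q (\<sigma> i)) ` {1..n}))
      = (\<Sum>\<sigma> | \<sigma> permutes {1..n}. ?f \<sigma>)"
    by (subst sum_permutations_compose_right[OF p]) simp
  then show ?thesis by (simp add: ell_perm_def)
qed

locale ordered_weights =
  fixes n :: nat and q :: "nat \<Rightarrow> real"
  assumes n: "2 \<le> n"
    and sum_q: "(\<Sum>i=1..n. q i) = 1"
    and q1_pos: "0 < q 1"
    and q_mono: "strict_mono_on {1..n} q"
begin

abbreviation perms :: "(nat \<Rightarrow> nat) set" where
  "perms \<equiv> {\<sigma>. \<sigma> permutes {1..n}}"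

lemma finite_perms: "finite perms" and id_perms: "id \<in> perms"
  by (simp_all add: finite_permutations permutes_id)

lemma perms_ne: "perms \<noteq> {}"
  using id_perms by blast

lemma perms_in: "\<sigma> \<in> perms \<Longrightarrow> i \<in> {1..n} \<Longrightarrow> \<sigma> i \<in> {1..n}"
  using permutes_in_image[of \<sigma> "{1..n}" i] by simp

lemma q_mono_le: "i \<in> {1..n} \<Longrightarrow> j \<in> {1..n} \<Longrightarrow> i \<le> j \<Longrightarrow> q i \<le> q j"
  using strict_mono_onD[OF q_mono, of i j] by (cases "i = j") auto

lemma q_bounds: "i \<in> {1..n} \<Longrightarrow> q 1 \<le> q i \<and> q i \<le> q n"
  using q_mono_le[of 1 i] q_mono_le[of i n] n by auto

lemma q_pos: "i \<in> {1..n} \<Longrightarrow> 0 < q i"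
  using q_bounds q1_pos by force

lemma q_inj: "inj_on q {1..n}"
  using q_mono strict_mono_on_imp_inj_on by blast

lemma q_le_1: "i \<in> {1..n} \<Longrightarrow> q i \<le> 1"
  using member_le_sum[of i "{1..n}" q] sum_q q_pos by (simp add: less_imp_le)

lemma q_perm_pos: "\<sigma> \<in> perms \<Longrightarrow> i \<in> {1..n} \<Longrightarrow> 0 < q (\<sigma> i)"
  using perms_in q_pos by blast

text \<open>Composing with a transposition shows that the sum does not depend on \<open>k\<close>.
  Adding it up over all \<open>n\<close> positions gives \<open>n!\<close>, because the weights sum
  to 1 under each permutation.\<close>

lemma sum_perms_q:
  assumes k: "k \<in> {1..n}"
  shows "(\<Sum>\<sigma>\<in>perms. q (\<sigma> k)) = fact (n - 1)"
proof -
  have indep: "(\<Sum>\<sigma>\<in>perms. q (\<sigma> i)) = (\<Sum>\<sigma>\<in>perms. q (\<sigma> k))" if "i \<in> {1..n}" for i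
    using sum_permutations_compose_right[OF permutes_swap_id[OF that k], of "\<lambda>\<sigma>. q (\<sigma> i)"] by simp
  have "real n * (\<Sum>\<sigma>\<in>perms. q (\<sigma> k)) = (\<Sum>i=1..n. \<Sum>\<sigma>\<in>perms. q (\<sigma> i))"
    using indep by simp
  also have "\<dots> = (\<Sum>\<sigma>\<in>perms. \<Sum>i=1..n. q (\<sigma> i))" by (rule sum.swap)
  also have "\<dots> = (\<Sum>\<sigma>\<in>perms. 1)"
  proof (rule sum.cong[OF refl])
    fix \<sigma> assume "\<sigma> \<in> perms"
    then show "(\<Sum>i=1..n. q (\<sigma> i)) = 1"
      using sum.permute[of \<sigma> "{1..n}" q] sum_q by (simp add: comp_def)
  qed
  also have "\<dots> = fact n" by (simp add: card_permutations)
  also have "\<dots> = real n * fact (n - 1)" using n by (simp add: fact_reduce)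
  finally show ?thesis using n by simp
qed

text \<open>Each maximum reduces to its \<open>k\<close>-th term, and \<open>sum_perms_q\<close>
  cancels the normalising factor. This identity makes the margins of the copula uniform.\<close>

lemma ell_perm_single:
  assumes k: "k \<in> {1..n}" and t: "0 \<le> t"
  shows "ell_perm n q (\<lambda>i. if i = k then t else 0) = t"
proof -
  have "Max ((\<lambda>i. (if i = k then t else 0) * q (\<sigma> i)) ` {1..n}) = t * q (\<sigma> k)" if "\<sigma> \<in> perms" for \<sigma>
  proof (rule Max_eqI)
    show "t * q (\<sigma> k) \<in> (\<lambda>i. (if i = k then t else 0) * q (\<sigma> i)) ` {1..n}"
      using k by (auto intro!: image_eqI[of _ _ k])
    have "0 \<le> t * q (\<sigma> k)" using t q_perm_pos[OF that k] by simp
    then show "y \<le> t * q (\<sigma> k)" if "y \<in> (\<lambda>i. (if i = k then t else 0) * q (\<sigma> i)) ` {1..n}" for y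
      using that by auto
  qed simp
  then have "ell_perm n q (\<lambda>i. if i = k then t else 0) = 1 / fact (n - 1) * (\<Sum>\<sigma>\<in>perms. t * q (\<sigma> k))"
    by (simp add: ell_perm_def)
  also have "\<dots> = t" using sum_perms_q[OF k] by (simp add: sum_distrib_left[symmetric])
  finally show ?thesis .
qed

text \<open>Needed later to recognise a spurious zero of \<open>ell_perm\<close> that comes from
  \<open>ln 0 = 0\<close>.\<close>

lemma ell_perm_pos:
  assumes x: "\<And>i. i \<in> {1..n} \<Longrightarrow> 0 \<le> x i" and k: "k \<in> {1..n}" "0 < x k"
  shows "0 < ell_perm n q x"
proof -
  have "0 < Max ((\<lambda>i. x i * q (\<sigma> i)) ` {1..n})" if "\<sigma> \<in> perms" for \<sigma>
  proof -
    have "0 < x k * q (\<sigma> k)" using k q_perm_pos[OF that k(1)] by simp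
    also have "\<dots> \<le> Max ((\<lambda>i. x i * q (\<sigma> i)) ` {1..n})" using k by (intro Max_ge) auto
    finally show ?thesis .
  qed
  then have "0 < (\<Sum>\<sigma>\<in>perms. Max ((\<lambda>i. x i * q (\<sigma> i)) ` {1..n}))"
    using finite_perms perms_ne by (intro sum_pos) auto
  then show ?thesis by (simp add: ell_perm_def)
qed

section \<open>Exponential clocks and the lifetimes they generate\<close>

definition clocks :: "((nat \<Rightarrow> nat) \<Rightarrow> real) measure" where
  "clocks = (\<Pi>\<^sub>M \<sigma>\<in>perms. expo)"

text \<open>The direction in which the vector of lifetimes points when the clock of
  \<open>\<sigma>\<close> alone determines it.\<close>

definition ray :: "(nat \<Rightarrow> nat) \<Rightarrow> nat \<Rightarrow> real" where
  "ray \<sigma> i = fact (n - 1) / q (\<sigma> i)"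

definition lifetime :: "((nat \<Rightarrow> nat) \<Rightarrow> real) \<Rightarrow> nat \<Rightarrow> real" where
  "lifetime e i = Min ((\<lambda>\<sigma>. e \<sigma> * ray \<sigma> i) ` perms)"

lemma ray_pos: "\<sigma> \<in> perms \<Longrightarrow> i \<in> {1..n} \<Longrightarrow> 0 < ray \<sigma> i"
  using q_perm_pos by (simp add: ray_def)

text \<open>Turns a bound on a minimum into one lower bound per clock, so that independence of the
  clocks applies.\<close>

lemma le_lifetime_iff:
  assumes "i \<in> {1..n}"
  shows "x \<le> lifetime e i \<longleftrightarrow> (\<forall>\<sigma>\<in>perms. x * q (\<sigma> i) / fact (n - 1) \<le> e \<sigma>)"
proof -
  have "x \<le> lifetime e i \<longleftrightarrow> (\<forall>\<sigma>\<in>perms. x \<le> e \<sigma> * ray \<sigma> i)"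
    using finite_perms perms_ne by (auto simp: lifetime_def Min_ge_iff)
  also have "\<dots> \<longleftrightarrow> (\<forall>\<sigma>\<in>perms. x * q (\<sigma> i) / fact (n - 1) \<le> e \<sigma>)"
    using q_perm_pos assms by (intro ball_cong) (auto simp: ray_def field_simps)
  finally show ?thesis .
qed

sublocale clock: product_prob_space "\<lambda>_. expo" perms
proof -
  interpret prob_space expo by (rule prob_space_expo)
  show "product_prob_space (\<lambda>_. expo)" by unfold_locales
qed

lemma prob_space_clocks: "prob_space clocks"
  unfolding clocks_def by (rule clock.P.prob_space_axioms)

lemma measure_clocks:
  assumes "J \<subseteq> perms" "\<And>\<sigma>. \<sigma> \<in> J \<Longrightarrow> A \<sigma> \<in> sets borel"
  shows "measure clocks {e \<in> space clocks. \<forall>\<sigma>\<in>J. e \<sigma> \<in> A \<sigma>} = (\<Prod>\<sigma>\<in>J. measure expo (A \<sigma>))"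
proof -
  interpret C: prob_space clocks by (rule prob_space_clocks)
  have "emeasure clocks {e \<in> space clocks. \<forall>\<sigma>\<in>J. e \<sigma> \<in> A \<sigma>} = (\<Prod>\<sigma>\<in>J. emeasure expo (A \<sigma>))"
    unfolding clocks_def
    using assms finite_perms by (intro clock.emeasure_PiM_Collect) (auto intro: finite_subset)
  then show ?thesis
    by (simp add: C.emeasure_eq_measure clock.M.emeasure_eq_measure prod_ennreal prod_nonneg)
qed

lemma lifetime_measurable: "i \<in> {1..n} \<Longrightarrow> (\<lambda>e. lifetime e i) \<in> borel_measurable clocks"
  unfolding lifetime_def clocks_def using finite_perms perms_ne
  by (intro borel_measurable_Min) auto

text \<open>The event asks each clock \<open>\<sigma>\<close> to exceed the largest
  \<open>x i * q (\<sigma> i) / (n - 1)!\<close>. By independence its probability is a product of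
  exponential tails, and the exponents add up to \<open>ell_perm n q x\<close>.\<close>

lemma measure_lifetime:
  assumes x: "\<And>i. i \<in> {1..n} \<Longrightarrow> 0 \<le> x i"
  shows "measure clocks {e \<in> space clocks. \<forall>i\<in>{1..n}. x i \<le> lifetime e i} = exp (- ell_perm n q x)"
proof -
  let ?m = "\<lambda>\<sigma>. Max ((\<lambda>i. x i * q (\<sigma> i)) ` {1..n}) / fact (n - 1)"
  have fact_pos: "(0::real) < fact (n - 1)" by simp
  have m: "?m \<sigma> \<le> t \<longleftrightarrow> (\<forall>i\<in>{1..n}. x i * q (\<sigma> i) / fact (n - 1) \<le> t)" for \<sigma> t
    using n by (simp add: pos_divide_le_eq Max_le_iff)
  have m_nonneg: "0 \<le> ?m \<sigma>" if "\<sigma> \<in> perms" for \<sigma>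
  proof -
    have "0 \<le> x 1 * q (\<sigma> 1)" using x[of 1] q_perm_pos[OF that, of 1] n by simp
    also have "\<dots> \<le> Max ((\<lambda>i. x i * q (\<sigma> i)) ` {1..n})" using n by (intro Max_ge) auto
    finally show ?thesis by simp
  qed
  have eq: "{e \<in> space clocks. \<forall>i\<in>{1..n}. x i \<le> lifetime e i} = {e \<in> space clocks. \<forall>\<sigma>\<in>perms. e \<sigma> \<in> {?m \<sigma>..}}"
    by (auto simp: le_lifetime_iff m simp del: atLeastAtMost_iff)
  have "measure clocks {e \<in> space clocks. \<forall>i\<in>{1..n}. x i \<le> lifetime e i} = (\<Prod>\<sigma>\<in>perms. measure expo {?m \<sigma>..})"
    unfolding eq by (rule measure_clocks) auto
  also have "\<dots> = (\<Prod>\<sigma>\<in>perms. exp (- ?m \<sigma>))"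
    by (rule prod.cong[OF refl]) (rule measure_expo_ge[OF m_nonneg])
  also have "\<dots> = exp (\<Sum>\<sigma>\<in>perms. - ?m \<sigma>)" using finite_perms by (rule exp_sum[symmetric])
  also have "(\<Sum>\<sigma>\<in>perms. - ?m \<sigma>) = - ell_perm n q x"
    by (simp only: ell_perm_def sum_negf flip: sum_divide_distrib) simp
  finally show ?thesis .
qed

lemma AE_clocks_pos: "AE e in clocks. \<forall>\<sigma>\<in>perms. 0 < e \<sigma>"
  unfolding clocks_def
  using finite_perms
  by (intro AE_finite_allI AE_PiM_component) (auto intro: prob_space_expo AE_expo_pos)

lemma lifetime_pos:
  assumes "\<forall>\<sigma>\<in>perms. 0 < e \<sigma>" "i \<in> {1..n}"
  shows "0 < lifetime e i"
  using assms finite_perms perms_ne ray_pos by (simp add: lifetime_def Min_gr_iff)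

section \<open>The joint law of \<open>exp (- lifetime)\<close> and its uniform margins\<close>

definition law :: "(nat \<Rightarrow> real) measure" where
  "law = distr clocks (\<Pi>\<^sub>M i\<in>{1..n}. borel) (\<lambda>e. \<lambda>i\<in>{1..n}. exp (- lifetime e i))"

lemma law_map_measurable:
  "(\<lambda>e. \<lambda>i\<in>{1..n}. exp (- lifetime e i)) \<in> measurable clocks (\<Pi>\<^sub>M i\<in>{1..n}. borel)"
  using lifetime_measurable by (intro measurable_restrict) auto

lemma sets_law: "sets law = sets (\<Pi>\<^sub>M i\<in>{1..n}. borel)"
  by (simp add: law_def)

lemma prob_space_law: "prob_space law"
  unfolding law_def using prob_space_clocks law_map_measurable by (rule prob_space.prob_space_distr)

lemma measure_law_Collect:
  assumes "{y \<in> space law. Q y} \<in> sets law"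
  shows "measure law {y \<in> space law. Q y}
    = measure clocks {e \<in> space clocks. Q (\<lambda>i\<in>{1..n}. exp (- lifetime e i))}"
  using assms unfolding law_def
  by (subst measure_distr[OF law_map_measurable])
     (auto intro!: arg_cong[where f = "measure clocks"] measurable_space[OF law_map_measurable])

lemma component_measurable_law: "k \<in> {1..n} \<Longrightarrow> (\<lambda>y. y k) \<in> borel_measurable law"
  unfolding measurable_cong_sets[OF sets_law refl]
  using measurable_component_singleton[of k "{1..n}" "\<lambda>_. borel :: real measure"] by simp

lemma law_event:
  assumes "J \<subseteq> {1..n}"
  shows "{y \<in> space law. \<forall>i\<in>J. y i \<le> u i} \<in> sets law"
proof -
  have fin: "finite J" using assms finite_subset by blast
  have "{y \<in> space law. y i \<le> u i} \<in> sets law" if "i \<in> J" for i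
  proof -
    have "(\<lambda>y. y i) \<in> borel_measurable law"
      using that assms by (intro component_measurable_law) auto
    from measurable_sets[OF this, of "{..u i}"] show ?thesis
      by (simp add: vimage_def Int_def conj_commute)
  qed
  then show ?thesis using fin by (intro sets.sets_Collect_finite_All) auto
qed

lemma exp_lifetime_le_iff: "0 < u \<Longrightarrow> exp (- lifetime e i) \<le> u \<longleftrightarrow> - ln u \<le> lifetime e i"
  by (metis add.inverse_inverse exp_le_cancel_iff exp_ln neg_le_iff_le)

lemma law_cdf:
  assumes u: "\<And>i. i \<in> {1..n} \<Longrightarrow> 0 < u i \<and> u i \<le> 1"
  shows "measure law {y \<in> space law. \<forall>i\<in>{1..n}. y i \<le> u i} = exp (- ell_perm n q (\<lambda>i. - ln (u i)))"
proof -
  have "measure law {y \<in> space law. \<forall>i\<in>{1..n}. y i \<le> u i}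
      = measure clocks {e \<in> space clocks. \<forall>i\<in>{1..n}. (\<lambda>i\<in>{1..n}. exp (- lifetime e i)) i \<le> u i}"
    by (intro measure_law_Collect law_event) simp
  also have "{e \<in> space clocks. \<forall>i\<in>{1..n}. (\<lambda>i\<in>{1..n}. exp (- lifetime e i)) i \<le> u i}
      = {e \<in> space clocks. \<forall>i\<in>{1..n}. - ln (u i) \<le> lifetime e i}"
    using u exp_lifetime_le_iff by (intro Collect_cong conj_cong ball_cong) auto
  finally show ?thesis
    using u by (subst (asm) measure_lifetime) auto
qed

text \<open>The margin is read off the joint survival function at a vector with one positive entry,
  where \<open>ell_perm_single\<close> evaluates it.\<close>

lemma law_margin:
  assumes k: "k \<in> {1..n}"
  shows "distr law borel (\<lambda>y. y k) = uniform_measure lborel {0..1}"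
proof (rule uniform_unitI)
  interpret L: prob_space law by (rule prob_space_law)
  interpret C: prob_space clocks by (rule prob_space_clocks)
  have meas: "(\<lambda>y. y k) \<in> borel_measurable law"
    using k by (rule component_measurable_law)
  then show "real_distribution (distr law borel (\<lambda>y. y k))" by simp
  fix u :: real assume u: "0 < u" "u \<le> 1"
  let ?x = "\<lambda>i. if i = k then - ln u else 0"
  have ev: "{e \<in> space clocks. c \<le> lifetime e i} \<in> sets clocks" if "i \<in> {1..n}" for i c
    using measurable_sets[OF lifetime_measurable[OF that], of "{c..}"]
    by (simp add: vimage_def Int_def conj_commute)
  have "cdf (distr law borel (\<lambda>y. y k)) u = measure law {y \<in> space law. \<forall>i\<in>{k}. y i \<le> u}"
    by (simp add: cdf_def measure_distr[OF meas] vimage_def Int_def conj_commute)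
  also have "\<dots> = measure clocks {e \<in> space clocks. - ln u \<le> lifetime e k}"
    using k u law_event[of "{k}" "\<lambda>_. u"]
    by (subst measure_law_Collect) (auto simp: exp_lifetime_le_iff)
  \<comment> \<open>The other coordinates get the threshold 0, which costs nothing because lifetimes
    are almost surely positive.\<close>
  also have "\<dots> = measure clocks {e \<in> space clocks. \<forall>i\<in>{1..n}. ?x i \<le> lifetime e i}"
  proof (rule C.finite_measure_eq_AE)
    show "AE e in clocks. e \<in> {e \<in> space clocks. - ln u \<le> lifetime e k} \<longleftrightarrow>
        e \<in> {e \<in> space clocks. \<forall>i\<in>{1..n}. ?x i \<le> lifetime e i}"
      using AE_clocks_pos
    proof eventually_elim
      case (elim e)
      then have "0 \<le> lifetime e i" if "i \<in> {1..n}" for i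
        using lifetime_pos[OF elim that] by simp
      then show ?case using k by auto
    qed
    show "{e \<in> space clocks. \<forall>i\<in>{1..n}. ?x i \<le> lifetime e i} \<in> sets clocks"
      using ev by (intro sets.sets_Collect_finite_All) auto
  qed (use ev k in auto)
  also have "\<dots> = exp (- ell_perm n q ?x)" using u by (intro measure_lifetime) auto
  also have "\<dots> = u" using ell_perm_single[OF k, of "- ln u"] u by simp
  finally show "cdf (distr law borel (\<lambda>y. y k)) u = u" .
qed

lemma AE_law: "k \<in> {1..n} \<Longrightarrow> AE y in law. 0 < y k \<and> y k \<le> 1"
  by (intro AE_uniform_margin law_margin component_measurable_law)

section \<open>The extreme-value copula with stable tail dependence function
  \<open>ell_perm n q\<close>\<close>

definition cop :: "(nat \<Rightarrow> real) \<Rightarrow> real" where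
  "cop u = measure law {y \<in> space law. \<forall>k\<in>{1..n}. y k \<le> u k}"

lemma cop_zero:
  assumes "k \<in> {1..n}" "u k \<le> 0"
  shows "cop u = 0"
proof -
  interpret L: prob_space law by (rule prob_space_law)
  have "cop u = measure law {}"
    unfolding cop_def
  proof (rule L.finite_measure_eq_AE)
    show "AE y in law. y \<in> {y \<in> space law. \<forall>k\<in>{1..n}. y k \<le> u k} \<longleftrightarrow> y \<in> {}"
      using AE_law[OF assms(1)] by eventually_elim (use assms in force)
  qed (auto intro: law_event)
  then show ?thesis by simp
qed

text \<open>Raising \<open>u\<close> to the power \<open>t\<close> multiplies \<open>- ln u\<close>
  by \<open>t\<close>, so the power identity is the homogeneity of \<open>ell_perm\<close>.\<close>

lemma ev_copula_cop: "is_ev_copula n cop"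
  unfolding is_ev_copula_def
proof (intro conjI ballI allI impI)
  show "is_copula n cop"
    unfolding is_copula_def using prob_space_law sets_law law_margin
    by (intro exI[of _ law]) (auto simp: cop_def)
next
  fix u and t :: real assume u: "u \<in> cube n" and t: "0 < t"
  show "cop (\<lambda>k\<in>{1..n}. u k powr t) = cop u powr t"
  proof (cases "\<forall>k\<in>{1..n}. 0 < u k")
    case True
    have u1: "0 < u k \<and> u k \<le> 1" if "k \<in> {1..n}" for k
      using u that True by (auto simp: cube_def)
    have "cop (\<lambda>k\<in>{1..n}. u k powr t) = exp (- ell_perm n q (\<lambda>i. - ln ((\<lambda>k\<in>{1..n}. u k powr t) i)))"
      unfolding cop_def
    proof (rule law_cdf)
      fix i assume "i \<in> {1..n}"
      then show "0 < (\<lambda>k\<in>{1..n}. u k powr t) i \<and> (\<lambda>k\<in>{1..n}. u k powr t) i \<le> 1"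
        using u1[of i] t by (auto intro: powr_le1)
    qed
    also have "ell_perm n q (\<lambda>i. - ln ((\<lambda>k\<in>{1..n}. u k powr t) i)) = ell_perm n q (\<lambda>i. t * (- ln (u i)))"
      by (rule ell_perm_cong) (use u1 in \<open>auto simp: ln_powr\<close>)
    also have "\<dots> = t * ell_perm n q (\<lambda>i. - ln (u i))"
      using n t by (intro ell_perm_scale) auto
    also have "exp (- (t * ell_perm n q (\<lambda>i. - ln (u i)))) = exp (- ell_perm n q (\<lambda>i. - ln (u i))) powr t"
      by (simp add: powr_def)
    also have "exp (- ell_perm n q (\<lambda>i. - ln (u i))) = cop u"
      unfolding cop_def using u1 by (rule law_cdf[symmetric])
    finally show ?thesis .
  next
    case False
    then obtain k where k: "k \<in> {1..n}" "\<not> 0 < u k" by blast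
    moreover have "0 \<le> u k" using u k(1) by (auto simp: cube_def)
    ultimately have "u k = 0" by simp
    have "cop u = 0" "cop (\<lambda>k\<in>{1..n}. u k powr t) = 0"
      using k \<open>u k = 0\<close> by (auto intro!: cop_zero[of k])
    then show ?thesis by simp
  qed
qed

lemma ell_perm_sym_stdfs: "ell_perm n q \<in> sym_stdfs n"
proof -
  have "ell_perm n q x = - ln (cop (\<lambda>k\<in>{1..n}. exp (- x k)))" if x: "x \<in> orthant n" for x
  proof -
    have "cop (\<lambda>k\<in>{1..n}. exp (- x k)) = exp (- ell_perm n q (\<lambda>i. - ln ((\<lambda>k\<in>{1..n}. exp (- x k)) i)))"
      unfolding cop_def using x by (intro law_cdf) (auto simp: orthant_def)
    also have "ell_perm n q (\<lambda>i. - ln ((\<lambda>k\<in>{1..n}. exp (- x k)) i)) = ell_perm n q x"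
      by (rule ell_perm_cong) simp
    finally show ?thesis by (simp only: ln_exp minus_minus)
  qed
  then have "is_stdf n (ell_perm n q)"
    unfolding is_stdf_def using ev_copula_cop by blast
  then show ?thesis by (simp add: sym_stdfs_def ell_perm_permute)
qed

end

section \<open>Impossibility of the extension\<close>

text \<open>The shape of a multiple of a ray: \<open>i\<close> and \<open>j\<close> index the
  largest and the smallest value, whose ratio is exactly \<open>r\<close>.\<close>

definition regular :: "real \<Rightarrow> 'i set \<Rightarrow> ('i \<Rightarrow> real) \<Rightarrow> bool" where
  "regular r S x \<longleftrightarrow> inj_on x S \<and>
    (\<exists>i\<in>S. \<exists>j\<in>S. x i = r * x j \<and> (\<forall>k\<in>S. 0 < x k \<and> x j \<le> x k \<and> x k \<le> x i))"

lemma regular_comp: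
  assumes "inj_on p S"
  shows "regular r S (x \<circ> p) \<longleftrightarrow> regular r (p ` S) x"
  using assms unfolding regular_def by (simp add: comp_inj_on_iff)

text \<open>Let \<open>x a\<close> be the minimum and \<open>x b\<close> the maximum. Omitting a
  third index identifies \<open>x b\<close> as \<open>r * x a\<close>. Omitting \<open>b\<close>
  keeps the minimum, so \<open>r * x a\<close> is attained at another index as well, against
  injectivity.\<close>

lemma not_all_regular:
  assumes S: "finite S" "3 \<le> card S" and reg: "\<And>k. k \<in> S \<Longrightarrow> regular r (S - {k}) x"
  shows False
proof -
  \<comment> \<open>A third index serves twice: its omission keeps any two given indices together,
    which yields global injectivity, and it provides the middle element.\<close>
  have avoid: "\<exists>c\<in>S. c \<noteq> i \<and> c \<noteq> j" for i j
  proof -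
    have "card {i, j} \<le> 2" by (simp add: card_insert_if)
    then have "\<not> S \<subseteq> {i, j}" using S card_mono[of "{i, j}" S] by auto
    then show ?thesis by blast
  qed
  have inj: "i = j" if "i \<in> S" "j \<in> S" "x i = x j" for i j
  proof -
    obtain c where "c \<in> S" "c \<noteq> i" "c \<noteq> j" using avoid by blast
    then show ?thesis using reg[of c] that by (auto simp: regular_def inj_on_def)
  qed
  have ne: "S \<noteq> {}" using S by auto
  have "\<exists>a\<in>S. x a = Min (x ` S)" "\<exists>b\<in>S. x b = Max (x ` S)"
    using Min_in[of "x ` S"] Max_in[of "x ` S"] S(1) ne by (auto simp: image_iff eq_commute)
  then obtain a b where ab: "a \<in> S" "b \<in> S" "\<And>k. k \<in> S \<Longrightarrow> x a \<le> x k" "\<And>k. k \<in> S \<Longrightarrow> x k \<le> x b"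
    using S by (metis Max_ge Min_le finite_imageI imageI)
  have ext: "\<exists>i\<in>S - {c}. x i = r * x a" if "c \<in> S" "c \<noteq> a" for c
  proof -
    obtain i j where ij: "i \<in> S - {c}" "j \<in> S - {c}" "x i = r * x j" "\<And>k. k \<in> S - {c} \<Longrightarrow> x j \<le> x k"
      using reg[OF \<open>c \<in> S\<close>] unfolding regular_def by blast
    have "x j = x a" using ij(2) ij(4)[of a] ab that by force
    then show ?thesis using ij by auto
  qed
  obtain c where c: "c \<in> S" "c \<noteq> a" "c \<noteq> b" using avoid by blast
  have "a \<noteq> b" using inj[of a c] ab c by (metis order_antisym)
  obtain i j where ij: "i \<in> S - {c}" "j \<in> S - {c}" "x i = r * x j"
      "\<And>k. k \<in> S - {c} \<Longrightarrow> x j \<le> x k \<and> x k \<le> x i"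
    using reg[OF \<open>c \<in> S\<close>] unfolding regular_def by blast
  have "x i = x b" "x j = x a" using ij(1,2) ij(4)[of a] ij(4)[of b] ab c by force+
  then have "x b = r * x a" using ij by simp
  moreover obtain k where "k \<in> S - {b}" "x k = r * x a" using ext[of b] ab \<open>a \<noteq> b\<close> by auto
  ultimately show False using inj[of k b] ab by auto
qed

context ordered_weights
begin

section \<open>Irregular outcomes have probability of second order\<close>

definition spread :: real where
  "spread = q n / q 1"

text \<open>The threshold is \<open>spread * \<delta>\<close> and not \<open>\<delta>\<close>
  because, from one value below \<open>\<delta>\<close>, regularity bounds a second value only by
  \<open>spread * \<delta>\<close>. That second value is needed for the family omitting the
  first.\<close>

definition irregular :: "real \<Rightarrow> (nat \<Rightarrow> real) \<Rightarrow> bool" where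
  "irregular \<delta> x \<longleftrightarrow> (\<exists>i\<in>{1..n}. x i < spread * \<delta>) \<and> \<not> regular spread {1..n} x"

lemma spread_ge_1: "1 \<le> spread"
  using q_bounds[of 1] q1_pos n by (simp add: spread_def)

text \<open>The largest coordinate sits where \<open>\<sigma>\<close> takes the value 1, the
  smallest where it takes the value \<open>n\<close>; distinctness comes from injectivity of
  \<open>q\<close> and \<open>\<sigma>\<close>.\<close>

lemma regular_ray:
  assumes \<sigma>: "\<sigma> \<in> perms" and t: "0 < t" and x: "\<And>i. i \<in> {1..n} \<Longrightarrow> x i = t / q (\<sigma> i)"
  shows "regular spread {1..n} x"
proof -
  have \<sigma>': "\<sigma> permutes {1..n}" using \<sigma> by simp
  have inj: "inj_on x {1..n}"
  proof (rule inj_onI)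
    fix i j assume ij: "i \<in> {1..n}" "j \<in> {1..n}" "x i = x j"
    then have "q (\<sigma> i) = q (\<sigma> j)"
      using x t q_perm_pos[OF \<sigma> ij(1)] q_perm_pos[OF \<sigma> ij(2)] by (simp add: field_simps)
    then have "\<sigma> i = \<sigma> j" using inj_onD[OF q_inj] perms_in[OF \<sigma>] ij by blast
    then show "i = j" using permutes_inj[OF \<sigma>'] by (simp add: inj_eq)
  qed
  have "1 \<in> \<sigma> ` {1..n}" "n \<in> \<sigma> ` {1..n}" using permutes_image[OF \<sigma>'] n by auto
  then obtain i j where ij: "i \<in> {1..n}" "\<sigma> i = 1" "j \<in> {1..n}" "\<sigma> j = n" by (metis imageE)
  have qn: "0 < q n" using q_pos[of n] n by auto
  have "x i = spread * x j" using x[OF ij(1)] x[OF ij(3)] ij qn by (simp add: spread_def)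
  moreover have "0 < x k \<and> x j \<le> x k \<and> x k \<le> x i" if k: "k \<in> {1..n}" for k
    using x[OF k] x[OF ij(1)] x[OF ij(3)] ij t q_bounds[OF perms_in[OF \<sigma> k]] q_perm_pos[OF \<sigma> k] q1_pos
    by (auto intro!: divide_left_mono mult_pos_pos qn)
  ultimately show ?thesis using inj ij unfolding regular_def by blast
qed

text \<open>The clock \<open>\<sigma>\<close> behind the short lifetime is below
  \<open>spread\<^sup>2 * \<delta>\<close>, so all others are at least that large. It then attains
  the minimum in every coordinate, and the lifetimes lie on its ray.\<close>

lemma lifetime_regular:
  assumes e: "\<forall>\<sigma>\<in>perms. 0 < e \<sigma>" and \<delta>: "0 < \<delta>" and short: "\<exists>i\<in>{1..n}. lifetime e i < spread * \<delta>"
    and single: "\<And>\<sigma> \<tau>. \<sigma> \<in> perms \<Longrightarrow> \<tau> \<in> perms \<Longrightarrow> e \<sigma> < spread\<^sup>2 * \<delta> \<Longrightarrow> e \<tau> < spread\<^sup>2 * \<delta> \<Longrightarrow> \<sigma> = \<tau>"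
  shows "regular spread {1..n} (lifetime e)"
proof -
  define c :: real where "c = fact (n - 1)"
  have c: "1 \<le> c" by (simp add: c_def)
  obtain i where i: "i \<in> {1..n}" "lifetime e i < spread * \<delta>" using short by blast
  obtain \<sigma> where \<sigma>: "\<sigma> \<in> perms" "lifetime e i = e \<sigma> * ray \<sigma> i"
    using Min_in[of "(\<lambda>\<sigma>. e \<sigma> * ray \<sigma> i) ` perms"] finite_perms perms_ne
    unfolding lifetime_def by blast
  have e_\<sigma>: "e \<sigma> * c < spread * \<delta> * q (\<sigma> i)"
    using i \<sigma> q_perm_pos[OF \<sigma>(1) i(1)] by (simp add: ray_def c_def field_simps)
  have sd: "0 < spread * \<delta>" using spread_ge_1 \<delta> by simp
  have "e \<sigma> \<le> e \<sigma> * c" using c e \<sigma>(1) mult_left_mono[of 1 c "e \<sigma>"] by (simp add: less_imp_le)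
  also note e_\<sigma>
  also have "spread * \<delta> * q (\<sigma> i) \<le> spread * \<delta>"
    using sd q_le_1[OF perms_in[OF \<sigma>(1) i(1)]] by (simp add: mult_le_cancel_left2)
  also have "spread * \<delta> \<le> spread\<^sup>2 * \<delta>"
    using spread_ge_1 sd mult_right_mono[of 1 spread "spread * \<delta>"] by (simp add: power2_eq_square)
  finally have e_\<sigma>_small: "e \<sigma> < spread\<^sup>2 * \<delta>" .
  have "lifetime e j = e \<sigma> * c / q (\<sigma> j)" if j: "j \<in> {1..n}" for j
    unfolding lifetime_def
  proof (rule Min_eqI)
    show "finite ((\<lambda>\<sigma>. e \<sigma> * ray \<sigma> j) ` perms)" using finite_perms by simp
    show "e \<sigma> * c / q (\<sigma> j) \<in> (\<lambda>\<sigma>. e \<sigma> * ray \<sigma> j) ` perms"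
      using \<sigma>(1) by (auto simp: ray_def c_def)
    fix y assume "y \<in> (\<lambda>\<sigma>. e \<sigma> * ray \<sigma> j) ` perms"
    then obtain \<tau> where \<tau>: "\<tau> \<in> perms" "y = e \<tau> * c / q (\<tau> j)" by (auto simp: ray_def c_def)
    show "e \<sigma> * c / q (\<sigma> j) \<le> y"
    proof (cases "\<tau> = \<sigma>")
      case False
      then have large: "spread\<^sup>2 * \<delta> \<le> e \<tau>" using single[OF \<sigma>(1) \<tau>(1) e_\<sigma>_small] by force
      \<comment> \<open>Passing from coordinate \<open>i\<close> to \<open>j\<close> on one ray
        costs at most a factor \<open>spread\<close>, which explains the square. A competing clock
        contributes at least its own value, since \<open>c \<ge> 1\<close> and weights are at most
        1.\<close>
      have "e \<sigma> * c / q (\<sigma> j) \<le> spread * \<delta> * q n / q 1"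
      proof (rule frac_le)
        have "spread * \<delta> * q (\<sigma> i) \<le> spread * \<delta> * q n"
          using sd q_bounds[OF perms_in[OF \<sigma>(1) i(1)]] by (intro mult_left_mono) auto
        then show "e \<sigma> * c \<le> spread * \<delta> * q n" using e_\<sigma> by linarith
        show "0 \<le> spread * \<delta> * q n" using sd q_pos[of n] n by simp
      qed (use q1_pos q_bounds[OF perms_in[OF \<sigma>(1) j]] in auto)
      also have "\<dots> = spread\<^sup>2 * \<delta>" by (simp add: spread_def power2_eq_square)
      also note large
      also have "e \<tau> \<le> e \<tau> * c" using c e \<tau>(1) mult_left_mono[of 1 c "e \<tau>"] by (simp add: less_imp_le)
      also have "\<dots> \<le> e \<tau> * c / q (\<tau> j)"
        using c e \<tau>(1) q_le_1[OF perms_in[OF \<tau>(1) j]] q_perm_pos[OF \<tau>(1) j]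
          mult_left_mono[of "q (\<tau> j)" 1 "e \<tau> * c"]
        by (simp add: le_divide_eq less_imp_le)
      finally show ?thesis using \<tau> by simp
    qed (use \<tau> in simp)
  qed
  moreover have "0 < e \<sigma> * c" using e \<sigma>(1) c by simp
  ultimately show ?thesis using regular_ray[OF \<sigma>(1)] by blast
qed

lemma sets_irregular:
  assumes f: "\<And>i. i \<in> {1..n} \<Longrightarrow> f i \<in> borel_measurable N"
  shows "{y \<in> space N. irregular \<delta> (\<lambda>i. f i y)} \<in> sets N"
  unfolding irregular_def regular_def inj_on_def
  by (intro sets.sets_Collect_conj sets.sets_Collect_neg sets.sets_Collect_finite_Ex
      sets.sets_Collect_finite_All sets.sets_Collect_imp sets.sets_Collect_const
      borel_measurable_eq borel_measurable_le borel_measurable_less borel_measurable_times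
      borel_measurable_const f) simp_all

lemma sets_irregular_law:
  "{y \<in> space (\<Pi>\<^sub>M i\<in>{1..n}. borel). irregular \<delta> (\<lambda>i. - ln (y i :: real))} \<in> sets (\<Pi>\<^sub>M i\<in>{1..n}. borel)"
  by (rule sets_irregular) measurable

text \<open>By \<open>lifetime_regular\<close>, an irregular outcome almost surely has two distinct
  clocks below \<open>spread\<^sup>2 * \<delta>\<close>. Independence bounds each such pair by the
  square of this number, and there are at most \<open>(n!)\<^sup>2\<close> ordered pairs.\<close>

lemma measure_law_irregular:
  assumes \<delta>: "0 < \<delta>"
  shows "measure law {y \<in> space law. irregular \<delta> (\<lambda>i. - ln (y i))} \<le> (fact n * spread\<^sup>2 * \<delta>)\<^sup>2"
proof -
  interpret C: prob_space clocks by (rule prob_space_clocks)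
  define \<theta> where "\<theta> = spread\<^sup>2 * \<delta>"
  have \<theta>: "0 \<le> \<theta>" using \<delta> by (simp add: \<theta>_def)
  define D where "D = {(\<sigma>, \<tau>). \<sigma> \<in> perms \<and> \<tau> \<in> perms \<and> \<sigma> \<noteq> \<tau>}"
  define B where "B = (\<lambda>(\<sigma>, \<tau>). {e \<in> space clocks. \<forall>\<rho>\<in>{\<sigma>, \<tau>}. e \<rho> \<in> {..<\<theta>}})"
  have D: "D \<subseteq> perms \<times> perms" by (auto simp: D_def)
  have finD: "finite D" using D finite_perms finite_subset by blast
  have card_perms: "card perms = fact n" by (simp add: card_permutations)
  have "card D \<le> (fact n)\<^sup>2"
    using card_mono[OF _ D] finite_perms by (simp add: card_cartesian_product card_perms power2_eq_square)
  then have cardD: "real (card D) \<le> (fact n)\<^sup>2"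
    by (metis of_nat_fact of_nat_le_iff of_nat_power)
  have B_sets: "B p \<in> sets clocks" if "p \<in> D" for p
    using that unfolding B_def D_def clocks_def by (auto split: prod.split)
  have B_le: "measure clocks (B p) \<le> \<theta>\<^sup>2" if pD: "p \<in> D" for p
  proof -
    obtain \<sigma> \<tau> where p: "p = (\<sigma>, \<tau>)" "\<sigma> \<in> perms" "\<tau> \<in> perms" "\<sigma> \<noteq> \<tau>"
      using pD by (auto simp: D_def)
    have "measure clocks (B p) = (\<Prod>\<rho>\<in>{\<sigma>, \<tau>}. measure expo {..<\<theta>})"
      unfolding p(1) B_def prod.case using p by (intro measure_clocks) auto
    also have "\<dots> = (measure expo {..<\<theta>})\<^sup>2" using p by (simp add: power2_eq_square)
    also have "\<dots> \<le> \<theta>\<^sup>2" using measure_expo_less[OF \<theta>] by (intro power_mono) auto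
    finally show ?thesis .
  qed
  let ?U = "\<lambda>e. \<lambda>i\<in>{1..n}. exp (- lifetime e i)"
  have irregular_restrict: "irregular \<delta> (\<lambda>i. - ln (?U e i)) \<longleftrightarrow> irregular \<delta> (lifetime e)" for e
    unfolding irregular_def regular_def inj_on_def by simp
  have sp: "space law = space (\<Pi>\<^sub>M i\<in>{1..n}. borel)" by (rule sets_eq_imp_space_eq[OF sets_law])
  have "measure law {y \<in> space law. irregular \<delta> (\<lambda>i. - ln (y i))}
      = measure clocks {e \<in> space clocks. irregular \<delta> (\<lambda>i. - ln (?U e i))}"
    by (rule measure_law_Collect) (simp add: sp sets_law sets_irregular_law)
  also have "\<dots> \<le> measure clocks (\<Union>p\<in>D. B p)"
  proof (rule C.finite_measure_mono_AE)
    show "AE e in clocks. e \<in> {e \<in> space clocks. irregular \<delta> (\<lambda>i. - ln (?U e i))} \<longrightarrow> e \<in> (\<Union>p\<in>D. B p)"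
      using AE_clocks_pos
    proof eventually_elim
      case (elim e)
      show ?case
      proof
        assume "e \<in> {e \<in> space clocks. irregular \<delta> (\<lambda>i. - ln (?U e i))}"
        then have e: "e \<in> space clocks" "irregular \<delta> (lifetime e)"
          by (simp_all only: mem_Collect_eq irregular_restrict)
        then obtain \<sigma> \<tau> where "\<sigma> \<in> perms" "\<tau> \<in> perms" "e \<sigma> < \<theta>" "e \<tau> < \<theta>" "\<sigma> \<noteq> \<tau>"
          using lifetime_regular[OF elim \<delta>] unfolding irregular_def \<theta>_def by blast
        then have "(\<sigma>, \<tau>) \<in> D" "e \<in> B (\<sigma>, \<tau>)" using e by (auto simp: D_def B_def)
        then show "e \<in> (\<Union>p\<in>D. B p)" by blast
      qed
    qed
    show "(\<Union>p\<in>D. B p) \<in> sets clocks" using finD B_sets by (intro sets.finite_UN) auto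
  qed
  also have "\<dots> \<le> (\<Sum>p\<in>D. measure clocks (B p))"
    using finD B_sets by (intro C.finite_measure_subadditive_finite) auto
  also have "\<dots> \<le> (\<Sum>p\<in>D. \<theta>\<^sup>2)" by (intro sum_mono B_le)
  also have "\<dots> = real (card D) * \<theta>\<^sup>2" by simp
  also have "\<dots> \<le> (fact n)\<^sup>2 * \<theta>\<^sup>2" using cardD by (intro mult_right_mono) auto
  also have "\<dots> = (fact n * spread\<^sup>2 * \<delta>)\<^sup>2" by (simp add: \<theta>_def power_mult_distrib)
  finally show ?thesis .
qed

text \<open>All \<open>n\<close>-subfamilies of the first \<open>n + 1\<close> coordinates have the
  law of the clock model. Their irregular events have total probability of order
  \<open>\<delta>\<^sup>2\<close>, too little to cover an event of order \<open>\<delta>\<close>,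
  and an outcome left over contradicts \<open>not_all_regular\<close>.\<close>

lemma not_margin:
  assumes d: "n + 1 \<le> d" and l: "l \<in> sym_stdfs d" and margin: "is_margin n (ell_perm n q) d l"
  shows False
proof -
  obtain C where C: "is_ev_copula d C" "\<And>x. x \<in> orthant d \<Longrightarrow> l x = - ln (C (\<lambda>k\<in>{1..d}. exp (- x k)))"
    using l unfolding sym_stdfs_def is_stdf_def by blast
  have sym: "l (x \<circ> p) = l x" if "p permutes {1..d}" "x \<in> orthant d" for p x
    using l that unfolding sym_stdfs_def by blast
  obtain M where M: "prob_space M" "sets M = sets (\<Pi>\<^sub>M i\<in>{1..d}. (borel :: real measure))"
      "\<And>k. k \<in> {1..d} \<Longrightarrow> distr M borel (\<lambda>y. y k) = uniform_measure lborel {0..1}"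
      "\<And>u. u \<in> cube d \<Longrightarrow> C u = measure M {y \<in> space M. \<forall>k\<in>{1..d}. y k \<le> u k}"
    using C(1) unfolding is_ev_copula_def is_copula_def by blast
  interpret M: prob_space M by (rule M(1))
  have comp: "(\<lambda>y. y k) \<in> borel_measurable M" if "k \<in> {1..d}" for k
    unfolding measurable_cong_sets[OF M(2) refl]
    using measurable_component_singleton[OF that, of "\<lambda>_. borel :: real measure"] by simp
  have AE_M: "AE y in M. 0 < y k \<and> y k \<le> 1" if "k \<in> {1..d}" for k
    using that by (intro AE_uniform_margin M(3) comp)
  have event: "{y \<in> space M. \<forall>i\<in>J. y (f i) \<le> u i} \<in> sets M"
    if "finite J" "f ` J \<subseteq> {1..d}" for J :: "nat set" and f u
  proof -
    have "{y \<in> space M. y (f i) \<le> u i} \<in> sets M" if "i \<in> J" for i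
      using measurable_sets[OF comp, of "f i" "{..u i}"] that \<open>f ` J \<subseteq> {1..d}\<close>
      by (simp add: vimage_def Int_def conj_commute image_subset_iff)
    then show ?thesis using that by (intro sets.sets_Collect_finite_All) auto
  qed
  have p_in: "p i \<in> {1..d}" if "p permutes {1..d}" "i \<in> {1..n}" for p i
    using permutes_in_image[OF that(1), of i] that(2) d by auto
  have cdf: "measure M {y \<in> space M. \<forall>i\<in>{1..n}. y (p i) \<le> u i} = exp (- ell_perm n q (\<lambda>i. - ln (u i)))"
    if p: "p permutes {1..d}" and u: "\<And>i. i \<in> {1..n} \<Longrightarrow> 0 < u i \<and> u i \<le> 1" for p u
  proof -
    define x where "x = (\<lambda>k\<in>{1..n}. - ln (u k))"
    define x' where "x' = (\<lambda>k\<in>{1..d}. if k \<le> n then x k else 0)"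
    \<comment> \<open>The corner with \<open>u i\<close> at position \<open>p i\<close> for
      \<open>i \<le> n\<close> and 1 elsewhere; entries 1 impose almost surely no condition.\<close>
    define v where "v = (\<lambda>k\<in>{1..d}. exp (- (x' \<circ> inv p) k))"
    let ?m = "measure M {y \<in> space M. \<forall>i\<in>{1..n}. y (p i) \<le> u i}"
    have x: "x \<in> orthant n" using u by (auto simp: x_def orthant_def)
    have x': "x' \<in> orthant d" using x by (auto simp: x'_def orthant_def)
    have inv_p: "inv p permutes {1..d}" using p by (rule permutes_inv)
    have x'p: "x' \<circ> inv p \<in> orthant d"
      using x' permutes_in_image[OF inv_p] permutes_not_in[OF inv_p]
      by (auto simp: orthant_def PiE_iff extensional_def)
    have v_cube: "v \<in> cube d" using x'p by (auto simp: v_def cube_def orthant_def)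
    have v_p: "v (p i) = (if i \<le> n then u i else 1)" if "i \<in> {1..d}" for i
      using that u[of i] permutes_in_image[OF p, of i] permutes_inverses(2)[OF p]
      by (simp add: v_def x'_def x_def)
    have ball_p: "(\<forall>k\<in>{1..d}. Q k) \<longleftrightarrow> (\<forall>i\<in>{1..d}. Q (p i))" for Q
      using permutes_image[OF p] by (metis (no_types, lifting) image_iff imageI)
    have "ell_perm n q x = l (x' \<circ> inv p)"
      using margin x sym[OF inv_p x'] unfolding is_margin_def x'_def by metis
    also have "\<dots> = - ln (C v)" unfolding v_def by (rule C(2)[OF x'p])
    also have "C v = measure M {y \<in> space M. \<forall>k\<in>{1..d}. y k \<le> v k}" by (rule M(4)[OF v_cube])
    also have "\<dots> = ?m"
    proof (rule M.finite_measure_eq_AE)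
      have "AE y in M. \<forall>k\<in>{1..d}. y k \<le> 1"
        by (intro AE_finite_allI) (auto intro: AE_mp[OF AE_M])
      then show "AE y in M. y \<in> {y \<in> space M. \<forall>k\<in>{1..d}. y k \<le> v k} \<longleftrightarrow>
          y \<in> {y \<in> space M. \<forall>i\<in>{1..n}. y (p i) \<le> u i}"
      proof eventually_elim
        case (elim y)
        then have le1: "y (p i) \<le> 1" if "i \<in> {1..d}" for i
          using that permutes_in_image[OF p, of i] by blast
        have "(\<forall>k\<in>{1..d}. y k \<le> v k) \<longleftrightarrow> (\<forall>i\<in>{1..d}. y (p i) \<le> v (p i))" by (rule ball_p)
        also have "\<dots> \<longleftrightarrow> (\<forall>i\<in>{1..n}. y (p i) \<le> u i)"
          using v_p le1 d by (force split: if_splits)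
        finally show ?case by simp
      qed
    qed (use event[of "{1..d}" id v] event[of "{1..n}" p u, OF _ image_subsetI[OF p_in[OF p]]] in auto)
    finally have ell: "ell_perm n q x = - ln ?m" .
    \<comment> \<open>As \<open>ln 0 = 0\<close> in HOL, the equation for \<open>- ln ?m\<close>
      does not by itself exclude \<open>?m = 0\<close>. In that case \<open>ell_perm\<close> would
      vanish, forcing every \<open>u i = 1\<close> and hence \<open>?m = 1\<close>.\<close>
    have "?m \<noteq> 0"
    proof
      assume 0: "?m = 0"
      have x_nonneg: "0 \<le> x i" if "i \<in> {1..n}" for i using u[OF that] that by (simp add: x_def)
      have "ell_perm n q x = 0" using ell 0 by simp
      then have "x i = 0" if "i \<in> {1..n}" for i
        using ell_perm_pos[of x i] x_nonneg that by force
      then have u1: "u i = 1" if "i \<in> {1..n}" for i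
        using that u[OF that] ln_eq_zero_iff[of "u i"] by (auto simp: x_def)
      have "AE y in M. \<forall>i\<in>{1..n}. y (p i) \<le> 1"
        by (intro AE_finite_allI) (auto intro: AE_mp[OF AE_M[OF p_in[OF p]]])
      then have "?m = 1"
        using u1 event[of "{1..n}" p u, OF _ image_subsetI[OF p_in[OF p]]] by (subst M.prob_eq_1) auto
      then show False using 0 by simp
    qed
    then have "0 < ?m" by (simp add: less_le)
    then have "?m = exp (- ell_perm n q x)" using ell by simp
    also have "ell_perm n q x = ell_perm n q (\<lambda>i. - ln (u i))"
      by (rule ell_perm_cong) (simp add: x_def)
    finally show ?thesis .
  qed
  let ?res = "\<lambda>p (y :: nat \<Rightarrow> real). \<lambda>i\<in>{1..n}. y (p i)"
  have res: "?res p \<in> measurable M (\<Pi>\<^sub>M i\<in>{1..n}. borel)" if "p permutes {1..d}" for p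
    using comp p_in[OF that] by (intro measurable_restrict) auto
  have law_eq: "distr M (\<Pi>\<^sub>M i\<in>{1..n}. borel) (?res p) = law" if p: "p permutes {1..d}" for p
  proof (rule PiM_borel_eqI_unit_cube)
    let ?N = "distr M (\<Pi>\<^sub>M i\<in>{1..n}. borel) (?res p)"
    show "prob_space ?N" using res[OF p] by (rule M.prob_space_distr)
    show "AE y in ?N. 0 < y i \<and> y i \<le> 1" if "i \<in> {1..n}" for i
    proof (subst AE_distr_iff[OF res[OF p]])
      show "AE y in M. 0 < ?res p y i \<and> ?res p y i \<le> 1"
        using AE_M[OF p_in[OF p that]] that by simp
    qed (use that in measurable)
    show "measure ?N {y \<in> space ?N. \<forall>i\<in>{1..n}. y i \<le> u i} = measure law {y \<in> space law. \<forall>i\<in>{1..n}. y i \<le> u i}"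
      if u: "\<And>i. i \<in> {1..n} \<Longrightarrow> 0 < u i \<and> u i \<le> 1" for u
    proof -
      have ev: "{y \<in> space ?N. \<forall>i\<in>{1..n}. y i \<le> u i} \<in> sets (\<Pi>\<^sub>M i\<in>{1..n}. borel)"
        using law_event[of "{1..n}" u] sets_eq_imp_space_eq[OF sets_law] by (simp add: sets_law)
      have "measure ?N {y \<in> space ?N. \<forall>i\<in>{1..n}. y i \<le> u i}
          = measure M {y \<in> space M. \<forall>i\<in>{1..n}. y (p i) \<le> u i}"
        using measurable_space[OF res[OF p]]
        by (subst measure_distr[OF res[OF p] ev]) (auto intro!: arg_cong[where f = "measure M"])
      then show ?thesis using cdf[OF p u] law_cdf[OF u] by simp
    qed
  qed (use prob_space_law sets_law AE_law in auto)
  let ?A = "\<lambda>p \<delta>. {y \<in> space M. irregular \<delta> (\<lambda>i. - ln (y (p i)))}"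
  have irregular_restrict: "irregular \<delta> (\<lambda>i. - ln (?res p y i)) \<longleftrightarrow> irregular \<delta> (\<lambda>i. - ln (y (p i)))" for \<delta> p y
    unfolding irregular_def regular_def inj_on_def by simp
  have A: "?A p \<delta> \<in> sets M" "measure M (?A p \<delta>) \<le> (fact n * spread\<^sup>2 * \<delta>)\<^sup>2"
    if p: "p permutes {1..d}" and \<delta>: "0 < \<delta>" for p \<delta>
  proof -
    let ?I = "{y \<in> space (\<Pi>\<^sub>M i\<in>{1..n}. borel). irregular \<delta> (\<lambda>i. - ln (y i :: real))}"
    have eq: "?A p \<delta> = ?res p -` ?I \<inter> space M"
      using measurable_space[OF res[OF p]] by (auto simp only: irregular_restrict mem_Collect_eq vimage_eq Int_iff)
    show "?A p \<delta> \<in> sets M" unfolding eq by (rule measurable_sets[OF res[OF p] sets_irregular_law])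
    have "measure M (?A p \<delta>) = measure law ?I"
      unfolding eq law_eq[OF p, symmetric] by (rule measure_distr[OF res[OF p] sets_irregular_law, symmetric])
    then show "measure M (?A p \<delta>) \<le> (fact n * spread\<^sup>2 * \<delta>)\<^sup>2"
      using measure_law_irregular[OF \<delta>] sets_eq_imp_space_eq[OF sets_law] by simp
  qed
  \<comment> \<open>\<open>K\<close> dominates the constant of the union bound over
    \<open>n + 1\<close> families. The choice of \<open>\<delta>\<close> then gives
    \<open>K * \<delta> * \<delta> < \<delta> / 2\<close>, and the summand 1 keeps \<open>K\<close>
    positive and \<open>\<delta>\<close> at most 1.\<close>
  define K where "K = real (n + 1) * (fact n * spread\<^sup>2)\<^sup>2 + 1"
  have K: "1 \<le> K" by (simp add: K_def)
  define \<delta> where "\<delta> = 1 / (4 * K)"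
  have \<delta>: "0 < \<delta>" "\<delta> \<le> 1" "K * \<delta> < 1 / 2" using K by (simp_all add: \<delta>_def field_simps)
  \<comment> \<open>Swapping \<open>k\<close> with \<open>n + 1\<close> maps \<open>{1..n}\<close>
    onto \<open>{1..n+1} - {k}\<close>, so \<open>p k\<close> selects the subfamily without
    \<open>k\<close>.\<close>
  define p where "p = (\<lambda>k. Transposition.transpose k (n + 1))"
  have p: "p k permutes {1..d}" if "k \<in> {1..n+1}" for k
    unfolding p_def using that d by (intro permutes_swap_id) auto
  define E where "E = {y \<in> space M. exp (- \<delta>) < y 1}"
  have d1: "1 \<in> {1..d}" using d by auto
  have E: "E \<in> sets M"
    using measurable_sets[OF comp[OF d1], of "{exp (- \<delta>)<..}"]
    by (simp add: E_def vimage_def Int_def conj_commute)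
  have "measure M (space M - E) = measure (distr M borel (\<lambda>y. y 1)) {..exp (- \<delta>)}"
    using comp[OF d1] by (auto simp: measure_distr E_def intro!: arg_cong[where f = "measure M"])
  also have "\<dots> = exp (- \<delta>)" using \<delta> measure_uniform_unit_le[of "exp (- \<delta>)"] M(3)[OF d1] by simp
  finally have "1 - measure M E = exp (- \<delta>)" using M.prob_compl[OF E] by simp
  \<comment> \<open>Makes the probability of \<open>E\<close>, where the first coordinate of
    \<open>- ln y\<close> is below \<open>\<delta>\<close>, at least linear in
    \<open>\<delta>\<close>.\<close>
  moreover have "exp (- \<delta>) \<le> 1 - \<delta> / 2"
  proof -
    have "exp (- \<delta>) \<le> 1 / (1 + \<delta>)"
      using exp_ge_add_one_self[of \<delta>] \<delta> by (simp add: exp_minus inverse_eq_divide frac_le)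
    also have "\<dots> \<le> 1 - \<delta> / 2"
      using \<delta> mult_left_mono[of \<delta> 1 \<delta>] by (simp add: field_simps)
    finally show ?thesis .
  qed
  ultimately have E_ge: "\<delta> / 2 \<le> measure M E" by simp
  have "\<exists>y\<in>E. \<forall>k\<in>{1..n+1}. y \<notin> ?A (p k) \<delta>"
  proof (rule ccontr)
    assume "\<not> ?thesis"
    then have "E \<subseteq> (\<Union>k\<in>{1..n+1}. ?A (p k) \<delta>)" by blast
    then have "measure M E \<le> measure M (\<Union>k\<in>{1..n+1}. ?A (p k) \<delta>)"
      using A(1)[OF p \<delta>(1)] by (intro M.finite_measure_mono sets.finite_UN) auto
    also have "\<dots> \<le> (\<Sum>k\<in>{1..n+1}. measure M (?A (p k) \<delta>))"
      using A(1)[OF p \<delta>(1)] by (intro M.finite_measure_subadditive_finite) auto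
    also have "\<dots> \<le> (\<Sum>k\<in>{1..n+1}. (fact n * spread\<^sup>2 * \<delta>)\<^sup>2)"
      by (intro sum_mono A(2)[OF p \<delta>(1)])
    also have "\<dots> = (K - 1) * \<delta> * \<delta>" by (simp add: K_def power_mult_distrib power2_eq_square algebra_simps)
    also have "\<dots> \<le> (K * \<delta>) * \<delta>" using \<delta> by (intro mult_right_mono) auto
    also have "\<dots> < 1 / 2 * \<delta>" using \<delta> by (intro mult_strict_right_mono) auto
    finally show False using E_ge by simp
  qed
  then obtain y where y: "y \<in> space M" "exp (- \<delta>) < y 1"
      "\<And>k. k \<in> {1..n+1} \<Longrightarrow> \<not> irregular \<delta> ((\<lambda>i. - ln (y i)) \<circ> p k)"
    by (auto simp: E_def comp_def)
  define x where "x = (\<lambda>i. - ln (y i))"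
  have p_image: "p k ` {1..n} = {1..n+1} - {k}" if "k \<in> {1..n+1}" for k
  proof -
    have "p k ` ({1..n+1} - {n+1}) = p k ` {1..n+1} - p k ` {n+1}"
      by (rule image_set_diff) (simp add: p_def)
    also have "p k ` {1..n+1} = {1..n+1}"
      unfolding p_def using that by (intro permutes_image permutes_swap_id) auto
    also have "p k ` {n+1} = {k}" by (simp add: p_def)
    also have "{1..n+1} - {n+1} = {1..n}" by auto
    finally show ?thesis .
  qed
  have reg: "regular spread ({1..n+1} - {k}) x"
    if k: "k \<in> {1..n+1}" and i: "i \<in> {1..n+1} - {k}" "x i < spread * \<delta>" for k i
  proof -
    obtain j where "j \<in> {1..n}" "i = p k j" using i(1) unfolding p_image[OF k, symmetric] by blast
    then have "regular spread {1..n} (x \<circ> p k)"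
      using y(3)[OF k] i(2) unfolding irregular_def x_def by auto
    then show ?thesis by (subst (asm) regular_comp) (simp_all add: p_def flip: p_image[OF k])
  qed
  have x1: "x 1 < \<delta>"
  proof -
    have "ln (exp (- \<delta>)) < ln (y 1)" using y(2) by (subst ln_less_cancel_iff) (auto intro: less_trans[of 0 "exp (- \<delta>)"])
    then show ?thesis by (simp add: x_def)
  qed
  have x1': "x 1 < spread * \<delta>"
    using x1 mult_right_mono[OF spread_ge_1, of \<delta>] \<delta> by linarith
  have reg_n1: "regular spread ({1..n+1} - {n+1}) x" using x1' n by (intro reg[of _ 1]) auto
  \<comment> \<open>The family omitting 1 needs its own short member. Indices 1 and 2 both lie in
    the regular family omitting \<open>n + 1\<close>, so \<open>x 2\<close> is at most
    \<open>spread\<close> times the minimum there, hence at most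
    \<open>spread * x 1\<close>.\<close>
  have x2: "x 2 < spread * \<delta>"
  proof -
    obtain i j where ij: "x i = spread * x j" "\<And>k. k \<in> {1..n+1} - {n+1} \<Longrightarrow> x j \<le> x k \<and> x k \<le> x i"
      using reg_n1 unfolding regular_def by blast
    have "x 2 \<le> x i" "x j \<le> x 1" using ij(2)[of 2] ij(2)[of 1] n by auto
    then have "x 2 \<le> spread * x 1"
      using ij(1) spread_ge_1 mult_left_mono[of "x j" "x 1" spread] by linarith
    also have "\<dots> < spread * \<delta>" using x1 spread_ge_1 by simp
    finally show ?thesis .
  qed
  show False
  proof (rule not_all_regular[of "{1..n+1}"])
    fix k assume k: "k \<in> {1..n+1}"
    show "regular spread ({1..n+1} - {k}) x"
      using reg[OF k, of 1] reg[OF k, of 2] x1' x2 n by (cases "k = 1") auto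
  qed (use n in auto)
qed

end

theorem lemma2p5:
  fixes n :: nat and q :: "nat \<Rightarrow> real"
  assumes "2 \<le> n"
    and "(\<Sum>i=1..n. q i) = 1"
    and "0 < q 1"
    and "strict_mono_on {1..n} q"
    and "q n < 1"
  shows "ell_perm n q \<in> sym_stdfs n \<and>
    (\<forall>d\<ge>n + 1. \<not> (\<exists>l\<in>sym_stdfs d. is_margin n (ell_perm n q) d l))"
proof -
  interpret ordered_weights n q using assms by unfold_locales
  show ?thesis using ell_perm_sym_stdfs not_margin by blast
qed

end
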